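(* Let $U$ be a positive integer. For any nonnegative integer $A$, there exist $\Omega(2^{\sqrt{U}})$ distinct nondecreasing piecewise linear convex functions $\varphi:[1,U]^2\to[A,A+U]$ such that: the sets $\{p\in[1,\dots,U]^2 : \varphi(p)=A\}$ are pairwise distinct for distinct functions of the family, and each function takes value at least $A+1$ at all integer points of $[1,\dots,U]^2$ not in its set. Each of these functions is described as the pointwise maximum of $O(\sqrt{U})$ hyperplanes (affine functions).
   Context: $[1,U]$ denotes a real interval and $[1,\dots,U]$ denotes the set of integers $\{1,2,\dots,U\}$. A function on $[1,U]^2$ is nondecreasing if it is nondecreasing in each coordinate. *)

theory Defs
  imports "HOL-Analysis.Analysis" "HOL-Library.Landau_Symbols"
begin

definition square :: "nat \<Rightarrow> (real \<times> real) set" where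
  "square U = {1..real U} \<times> {1..real U}"

definition nondecreasing :: "nat \<Rightarrow> (real \<times> real \<Rightarrow> real) \<Rightarrow> bool" where
  "nondecreasing U \<phi> \<longleftrightarrow>
     (\<forall>y\<in>{1..real U}. mono_on {1..real U} (\<lambda>x. \<phi> (x, y))) \<and>
     (\<forall>x\<in>{1..real U}. mono_on {1..real U} (\<lambda>y. \<phi> (x, y)))"

definition affine_function :: "('a::real_inner \<Rightarrow> real) \<Rightarrow> bool" where
  "affine_function l \<longleftrightarrow> (\<exists>a c. \<forall>p. l p = a \<bullet> p + c)"

(* The pieces may overlap; on overlaps the affine functions necessarily agree,
   and as the pieces are closed, the function is continuous on S. *)
definition piecewise_linear_on :: "'a::euclidean_space set \<Rightarrow> ('a \<Rightarrow> real) \<Rightarrow> bool" where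
  "piecewise_linear_on S \<phi> \<longleftrightarrow>
     (\<exists>\<P>. finite \<P> \<and> \<Union>\<P> = S \<and>
        (\<forall>P\<in>\<P>. polyhedron P \<and> (\<exists>l. affine_function l \<and> (\<forall>p\<in>P. \<phi> p = l p))))"

definition max_of_affine_on :: "'a::euclidean_space set \<Rightarrow> nat \<Rightarrow> ('a \<Rightarrow> real) \<Rightarrow> bool" where
  "max_of_affine_on S m \<phi> \<longleftrightarrow>
     (\<exists>L. finite L \<and> L \<noteq> {} \<and> card L \<le> m \<and> (\<forall>l\<in>L. affine_function l) \<and>
        (\<forall>p\<in>S. \<phi> p = Max ((\<lambda>l. l p) ` L)))"

definition level_set :: "nat \<Rightarrow> nat \<Rightarrow> (real \<times> real \<Rightarrow> real) \<Rightarrow> (nat \<times> nat) set" where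
  "level_set U A \<phi> = {(i, j) \<in> {1..U} \<times> {1..U}. \<phi> (real i, real j) = real A}"

end

theory Submission
  imports Defs
begin

text \<open>
  Measured from the corner \<open>(U, U)\<close>, the points \<open>w\<^sub>j = (n - 1 - j, j\<^sup>2)\<close> for \<open>j < n\<close> lie on a
  parabola, and the affine function with integer coefficients that equals \<open>1 - (k - j)\<^sup>2\<close> at \<open>w\<^sub>j\<close>
  is \<open>1\<close> at \<open>w\<^sub>k\<close> and nonpositive at all the other \<open>w\<^sub>j\<close>. Hence, for each set \<open>T\<close> of indices, the
  positive part of the maximum of the functions with index \<open>k \<in> T\<close> vanishes at \<open>w\<^sub>j\<close> if and only if
  \<open>j \<notin> T\<close>, and it is at least \<open>1\<close> at each integer point where it does not vanish. The largest value
  of these functions is \<open>1 + k (2 (n - 1) - k) \<le> 1 + (n - 1)\<^sup>2\<close>, attained at \<open>(U, U)\<close>; it is at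
  most \<open>U\<close> for \<open>n = \<lceil>sqrt U\<rceil>\<close>, which yields \<open>2\<^sup>n\<close> functions.
\<close>

section \<open>Maxima of affine functions\<close>

lemma polyhedron_affine_le:
  fixes l l' :: "'a::euclidean_space \<Rightarrow> real"
  assumes "affine_function l" "affine_function l'"
  shows "polyhedron {p. l' p \<le> l p}"
proof -
  from assms obtain a c a' c' where "\<And>p. l p = a \<bullet> p + c" "\<And>p. l' p = a' \<bullet> p + c'"
    unfolding affine_function_def by blast
  then have "{p. l' p \<le> l p} = {p. (a' - a) \<bullet> p \<le> c - c'}"
    by (auto simp: inner_diff_left)
  then show ?thesis
    by (simp only: polyhedron_halfspace_le)
qed

text \<open>The pieces are the regions of \<open>S\<close> on which one fixed member of
  \<open>L\<close> dominates all the others. Each is \<open>S\<close> cut by finitely many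
  halfspaces, and every point lies in the piece of a maximiser at that point.\<close>

lemma piecewise_linear_on_Max_affine:
  fixes L :: "('a::euclidean_space \<Rightarrow> real) set"
  assumes S: "polyhedron S" and L: "finite L" "L \<noteq> {}" "\<And>l. l \<in> L \<Longrightarrow> affine_function l"
    and \<phi>: "\<And>p. p \<in> S \<Longrightarrow> \<phi> p = Max ((\<lambda>l. l p) ` L)"
  shows "piecewise_linear_on S \<phi>"
proof -
  define piece where "piece l = S \<inter> \<Inter>((\<lambda>l'. {p. l' p \<le> l p}) ` L)" for l
  have "\<Union>(piece ` L) = S"
  proof
    show "S \<subseteq> \<Union>(piece ` L)"
    proof
      fix p assume "p \<in> S"
      have "Max ((\<lambda>l. l p) ` L) \<in> (\<lambda>l. l p) ` L"
        using L by (intro Max_in) auto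
      then obtain l where l: "l \<in> L" "Max ((\<lambda>l. l p) ` L) = l p"
        by blast
      then have "p \<in> piece l"
        using \<open>p \<in> S\<close> L(1) unfolding piece_def by (auto simp flip: l(2))
      with l(1) show "p \<in> \<Union>(piece ` L)"
        by blast
    qed
  qed (auto simp: piece_def)
  moreover have "polyhedron (piece l)" if "l \<in> L" for l
    unfolding piece_def using S L that
    by (intro polyhedron_Int polyhedron_Inter) (auto intro: polyhedron_affine_le)
  moreover have "\<phi> p = l p" if "l \<in> L" "p \<in> piece l" for l p
  proof -
    have "Max ((\<lambda>l. l p) ` L) = l p"
      using that L(1) by (intro Max_eqI) (auto simp: piece_def)
    then show ?thesis
      using that \<phi> by (auto simp: piece_def)
  qed
  ultimately show ?thesis
    unfolding piecewise_linear_on_def using L(1,3) by (intro exI[of _ "piece ` L"]) blast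
qed

lemma affine_function_convex_combination:
  assumes "affine_function l" "u + v = 1"
  shows "l (u *\<^sub>R x + v *\<^sub>R y) = u * l x + v * l y"
proof -
  obtain a c where l: "\<And>p. l p = a \<bullet> p + c"
    using assms(1) unfolding affine_function_def by blast
  have "c = u * c + v * c"
    using assms(2) by (simp flip: distrib_right)
  then show ?thesis
    by (simp add: l inner_add_right distrib_left)
qed

text \<open>Each \<open>l\<close> commutes with convex combinations, so its value at the combined
  point is at most the same combination of the two maxima.\<close>

lemma convex_on_Max_affine:
  fixes L :: "('a::real_inner \<Rightarrow> real) set"
  assumes S: "convex S" and L: "finite L" "L \<noteq> {}" "\<And>l. l \<in> L \<Longrightarrow> affine_function l"
    and \<phi>: "\<And>p. p \<in> S \<Longrightarrow> \<phi> p = Max ((\<lambda>l. l p) ` L)"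
  shows "convex_on S \<phi>"
  unfolding convex_on_def
proof (intro conjI ballI allI impI S)
  fix x y and u v :: real
  assume xy: "x \<in> S" "y \<in> S" and uv: "0 \<le> u" "0 \<le> v" "u + v = 1"
  have le: "l p \<le> \<phi> p" if "l \<in> L" "p \<in> S" for l p
    using that \<phi> L(1) by (auto intro: Max_ge)
  have "\<phi> (u *\<^sub>R x + v *\<^sub>R y) = Max ((\<lambda>l. l (u *\<^sub>R x + v *\<^sub>R y)) ` L)"
    using S xy uv by (intro \<phi>) (auto simp: convex_def)
  also have "\<dots> \<le> u * \<phi> x + v * \<phi> y"
    using L xy uv le
    by (subst Max_le_iff)
       (auto simp: affine_function_convex_combination intro!: add_mono mult_left_mono)
  finally show "\<phi> (u *\<^sub>R x + v *\<^sub>R y) \<le> u * \<phi> x + v * \<phi> y" .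
qed

lemma polyhedron_square: "polyhedron (square U)"
proof -
  have "square U = cbox (1, 1) (real U, real U)"
    by (simp add: square_def cbox_Pair_eq)
  then show ?thesis
    using polyhedron_interval by metis
qed

section \<open>Cutting off points of a parabola\<close>

text \<open>With \<open>x = U - fst p\<close> and \<open>y = U - snd p\<close>, the line
  \<open>cut U n k p = 1\<close> is the tangent to the parabola \<open>y = (n - 1 - x)^2\<close> at
  the point with \<open>n - 1 - x = k\<close>.\<close>

definition cut :: "nat \<Rightarrow> nat \<Rightarrow> nat \<Rightarrow> real \<times> real \<Rightarrow> real" where
  "cut U n k p =
     1 + 2 * k * (real n - 1) - k\<^sup>2 - 2 * k * (real U - fst p) - (real U - snd p)"

lemma affine_function_cut: "affine_function (\<lambda>p. A + cut U n k p)"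
  unfolding affine_function_def
  by (rule exI[of _ "(2 * real k, 1)"],
      rule exI[of _ "A + 1 + 2 * k * (real n - 1) - k\<^sup>2 - 2 * k * real U - real U"])
     (auto simp: cut_def inner_prod_def algebra_simps)

lemma cut_mono:
  assumes "fst p \<le> fst q" "snd p \<le> snd q"
  shows "cut U n k p \<le> cut U n k q"
  using assms unfolding cut_def by (intro diff_mono mult_left_mono) auto

lemma cut_parabola:
  "cut U n k (real U - (real n - 1 - real j), real U - (real j)\<^sup>2) = 1 - (real k - real j)\<^sup>2"
  by (simp add: cut_def power2_eq_square algebra_simps)

text \<open>Monotonicity moves \<open>p\<close> to the corner of the square; completing the square
  there gives a bound independent of \<open>k\<close>.\<close>

lemma cut_le:
  assumes "(real n - 1)\<^sup>2 + 1 \<le> real U" "p \<in> square U"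
  shows "cut U n k p \<le> real U"
proof -
  have "cut U n k p \<le> cut U n k (real U, real U)"
    using assms(2) by (intro cut_mono) (auto simp: square_def)
  also have "\<dots> = (real n - 1)\<^sup>2 + 1 - (real n - 1 - real k)\<^sup>2"
    by (simp add: cut_def power2_eq_square algebra_simps)
  also have "\<dots> \<le> real U"
    using assms(1) zero_le_power2[of "real n - 1 - real k"] by linarith
  finally show ?thesis .
qed

lemma cut_Ints: "cut U n k (real i, real j) \<in> \<int>"
  by (simp add: cut_def)

text \<open>The constant function supplies the positive part, and keeps the maximum meaningful for
  empty \<open>T\<close>.\<close>

definition cuts :: "nat \<Rightarrow> nat \<Rightarrow> nat \<Rightarrow> nat set \<Rightarrow> (real \<times> real \<Rightarrow> real) set" where
  "cuts U A n T = insert (\<lambda>_. real A) ((\<lambda>k p. real A + cut U n k p) ` T)"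

text \<open>The restriction makes the function extensional, as membership in the function space of
  the theorem demands.\<close>

definition cut_max :: "nat \<Rightarrow> nat \<Rightarrow> nat \<Rightarrow> nat set \<Rightarrow> real \<times> real \<Rightarrow> real" where
  "cut_max U A n T = restrict (\<lambda>p. Max ((\<lambda>l. l p) ` cuts U A n T)) (square U)"

lemma cut_max_eq: "p \<in> square U \<Longrightarrow> cut_max U A n T p = Max ((\<lambda>l. l p) ` cuts U A n T)"
  by (simp add: cut_max_def)

lemma finite_cuts: "finite T \<Longrightarrow> finite (cuts U A n T)"
  by (simp add: cuts_def)

lemma cuts_nonempty: "cuts U A n T \<noteq> {}"
  by (simp add: cuts_def)

lemma card_cuts_le:
  assumes "finite T"
  shows "card (cuts U A n T) \<le> Suc (card T)"
  unfolding cuts_def using assms card_image_le[OF assms, of "\<lambda>k p. real A + cut U n k p"]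
  by (simp add: card_insert_if)

lemma affine_function_cuts:
  assumes "l \<in> cuts U A n T"
  shows "affine_function l"
proof -
  have "affine_function (\<lambda>_ :: real \<times> real. real A)"
    unfolding affine_function_def by (rule exI[of _ 0]) auto
  then show ?thesis
    using assms by (auto simp: cuts_def affine_function_cut)
qed

lemma cut_max_le_iff:
  assumes "finite T" "p \<in> square U"
  shows "cut_max U A n T p \<le> c \<longleftrightarrow> real A \<le> c \<and> (\<forall>k\<in>T. real A + cut U n k p \<le> c)"
  using assms by (simp add: cut_max_eq cuts_def image_image)

lemma cut_max_ge:
  assumes "finite T" "p \<in> square U"
  shows "real A \<le> cut_max U A n T p"
    and "k \<in> T \<Longrightarrow> real A + cut U n k p \<le> cut_max U A n T p"
  \<comment> \<open>Taking the maximum itself as the bound \<open>c\<close> makes the left-hand side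
    trivially true.\<close>
  using cut_max_le_iff[OF assms, of A n "cut_max U A n T p"] by auto

lemma cut_max_mono:
  assumes "finite T" "p \<in> square U" "q \<in> square U" "fst p \<le> fst q" "snd p \<le> snd q"
  shows "cut_max U A n T p \<le> cut_max U A n T q"
proof -
  have "real A + cut U n k p \<le> cut_max U A n T q" if "k \<in> T" for k
    using cut_mono[OF assms(4,5), of U n k] cut_max_ge(2)[OF assms(1,3) that, of A n] by linarith
  then show ?thesis
    using assms by (simp add: cut_max_le_iff cut_max_ge(1))
qed

lemma nondecreasing_cut_max: "finite T \<Longrightarrow> nondecreasing U (cut_max U A n T)"
  unfolding nondecreasing_def
  by (intro conjI ballI mono_onI cut_max_mono) (auto simp: square_def)

lemma grid_in_square: "(i, j) \<in> {1..U} \<times> {1..U} \<Longrightarrow> (real i, real j) \<in> square U"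
  by (auto simp: square_def)

text \<open>The value never drops below \<open>A\<close>, so being equal to \<open>A\<close> means
  being at most \<open>A\<close>.\<close>

lemma level_set_cut_max_iff:
  assumes "finite T" and ij: "(i, j) \<in> {1..U} \<times> {1..U}"
  shows "(i, j) \<in> level_set U A (cut_max U A n T) \<longleftrightarrow> (\<forall>k\<in>T. cut U n k (real i, real j) \<le> 0)"
proof -
  note sq = grid_in_square[OF ij]
  have "(i, j) \<in> level_set U A (cut_max U A n T) \<longleftrightarrow> cut_max U A n T (real i, real j) \<le> real A"
    using ij cut_max_ge(1)[OF assms(1) sq, of A n] by (auto simp: level_set_def)
  then show ?thesis
    by (simp add: cut_max_le_iff[OF assms(1) sq])
qed

text \<open>Off the level set some cut is positive; being an integer at grid points, it is at least
  1.\<close>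

lemma cut_max_gap:
  assumes "finite T" and ij: "(i, j) \<in> {1..U} \<times> {1..U} - level_set U A (cut_max U A n T)"
  shows "cut_max U A n T (real i, real j) \<ge> real A + 1"
proof -
  from ij have sq: "(real i, real j) \<in> square U"
    by (intro grid_in_square) blast
  obtain k where k: "k \<in> T" "cut U n k (real i, real j) > 0"
    using ij level_set_cut_max_iff[OF assms(1), of i j U A n] by (meson DiffE not_le)
  obtain z :: int where "cut U n k (real i, real j) = of_int z"
    using cut_Ints Ints_cases by metis
  with k(2) have "cut U n k (real i, real j) \<ge> 1"
    by simp
  then show ?thesis
    using cut_max_ge(2)[OF assms(1) sq k(1), of A n] by linarith
qed

text \<open>Only the cut with index \<open>j\<close> is positive at the \<open>j\<close>-th parabola
  point, so this point tests whether \<open>j\<close> belongs to \<open>T\<close>.\<close>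

lemma parabola_in_level_set_iff:
  assumes n: "(real n - 1)\<^sup>2 + 1 \<le> real U" and T: "T \<subseteq> {..<n}" and j: "j < n"
  shows "(U - (n - 1 - j), U - j\<^sup>2) \<in> level_set U A (cut_max U A n T) \<longleftrightarrow> j \<notin> T"
proof -
  \<comment> \<open>Since \<open>j < n\<close>, the natural number \<open>n - 1\<close> is not
    truncated.\<close>
  have "real ((n - 1)\<^sup>2 + 1) \<le> real U"
    using n j by (simp add: of_nat_diff)
  then have U: "(n - 1)\<^sup>2 < U"
    by linarith
  have "j\<^sup>2 \<le> (n - 1)\<^sup>2"
    using j by (intro power_mono) auto
  then have j2: "j\<^sup>2 < U"
    using U by linarith
  \<comment> \<open>Thus the bound on \<open>(n - 1)\<^sup>2\<close> controls both coordinates: the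
    point lies in the grid and the subtractions from \<open>U\<close> are exact.\<close>
  have "n - 1 \<le> (n - 1)\<^sup>2"
    by (simp only: power2_eq_square le_square)
  then have nj: "n - 1 - j < U"
    using U by linarith
  have real_eq: "(real (U - (n - 1 - j)), real (U - j\<^sup>2)) =
      (real U - (real n - 1 - real j), real U - (real j)\<^sup>2)"
    using j j2 nj by (simp add: of_nat_diff)
  have pos_iff: "1 - (real k - real j)\<^sup>2 \<le> 0 \<longleftrightarrow> k \<noteq> j" for k
  proof (cases "k = j")
    case False
    then have "1 \<le> \<bar>real k - real j\<bar>"
      by linarith
    then show ?thesis
      using False abs_le_square_iff[of 1 "real k - real j"] by simp
  qed simp
  have "(U - (n - 1 - j), U - j\<^sup>2) \<in> {1..U} \<times> {1..U}"
    using j2 nj by auto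
  then have "(U - (n - 1 - j), U - j\<^sup>2) \<in> level_set U A (cut_max U A n T) \<longleftrightarrow>
      (\<forall>k\<in>T. 1 - (real k - real j)\<^sup>2 \<le> 0)"
    using T finite_subset level_set_cut_max_iff real_eq cut_parabola by (metis finite_lessThan)
  also have "\<dots> \<longleftrightarrow> j \<notin> T"
    unfolding pos_iff by blast
  finally show ?thesis .
qed

lemma inj_on_level_set_cut_max:
  assumes n: "(real n - 1)\<^sup>2 + 1 \<le> real U"
  shows "inj_on (\<lambda>T. level_set U A (cut_max U A n T)) (Pow {..<n})"
proof (rule inj_onI)
  fix S T
  assume ST: "S \<in> Pow {..<n}" "T \<in> Pow {..<n}"
    and eq: "level_set U A (cut_max U A n S) = level_set U A (cut_max U A n T)"
  have "j \<in> S \<longleftrightarrow> j \<in> T" if "j < n" for j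
    using ST eq parabola_in_level_set_iff[OF n _ that] by blast
  then show "S = T"
    using ST by blast
qed

theorem theorem3p1:
  shows "\<exists>N M :: nat \<Rightarrow> nat.
    (\<lambda>U. real (N U)) \<in> \<Omega>(\<lambda>U. 2 powr sqrt (real U)) \<and>
    (\<lambda>U. real (M U)) \<in> O(\<lambda>U. sqrt (real U)) \<and>
    (\<forall>U\<ge>1. \<forall>A :: nat.
      \<exists>F \<subseteq> square U \<rightarrow>\<^sub>E {real A..real A + real U}.
        finite F \<and> card F = N U \<and>
        (\<forall>\<phi>\<in>F. nondecreasing U \<phi> \<and> piecewise_linear_on (square U) \<phi> \<and>
           convex_on (square U) \<phi> \<and> max_of_affine_on (square U) (M U) \<phi> \<and>
           (\<forall>(i, j) \<in> {1..U} \<times> {1..U} - level_set U A \<phi>.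
              \<phi> (real i, real j) \<ge> real A + 1)) \<and>
        inj_on (level_set U A) F)"
proof -
  \<comment> \<open>Rounding up makes \<open>2 ^ n U\<close> at least \<open>2 powr sqrt U\<close>,
    while \<open>n U - 1\<close> stays strictly below \<open>sqrt U\<close>.\<close>
  define n :: "nat \<Rightarrow> nat" where "n U = nat \<lceil>sqrt (real U)\<rceil>" for U
  have n_ge: "sqrt (real U) \<le> real (n U)" for U
    unfolding n_def by (rule real_nat_ceiling_ge)
  have n_less: "real (n U) < sqrt (real U) + 1" for U
    unfolding n_def by (simp add: ceiling_less_iff of_nat_nat) linarith
  have "(\<lambda>U. real (2 ^ n U)) \<in> \<Omega>(\<lambda>U. 2 powr sqrt (real U))"
  proof (rule landau_omega.bigI[of 1])
    show "\<forall>\<^sub>F U in sequentially. norm (real (2 ^ n U)) \<ge> 1 * norm (2 powr sqrt (real U))"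
      using n_ge by (simp flip: powr_realpow)
  qed simp
  \<comment> \<open>The successor counts the constant function besides at most \<open>n U\<close>
    cuts. The factor 3 comes from \<open>sqrt U + 2 \<le> 3 * sqrt U\<close> for
    \<open>U \<ge> 1\<close>.\<close>
  moreover have "(\<lambda>U. real (Suc (n U))) \<in> O(\<lambda>U. sqrt (real U))"
  proof (rule landau_o.bigI[of 3])
    show "\<forall>\<^sub>F U in sequentially. norm (real (Suc (n U))) \<le> 3 * norm (sqrt (real U))"
      using eventually_ge_at_top[of 1]
    proof eventually_elim
      case (elim U)
      then have "1 \<le> sqrt (real U)"
        by simp
      then have "real (Suc (n U)) \<le> 3 * sqrt (real U)"
        using n_less[of U] by linarith
      then show ?case
        by simp
    qed
  qed simp
  moreover have "\<exists>F \<subseteq> square U \<rightarrow>\<^sub>E {real A..real A + real U}.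
        finite F \<and> card F = 2 ^ n U \<and>
        (\<forall>\<phi>\<in>F. nondecreasing U \<phi> \<and> piecewise_linear_on (square U) \<phi> \<and>
           convex_on (square U) \<phi> \<and> max_of_affine_on (square U) (Suc (n U)) \<phi> \<and>
           (\<forall>(i, j) \<in> {1..U} \<times> {1..U} - level_set U A \<phi>.
              \<phi> (real i, real j) \<ge> real A + 1)) \<and>
        inj_on (level_set U A) F" if "U \<ge> 1" for U A :: nat
  proof -
    have n1: "1 \<le> n U"
      using n_ge[of U] that by (cases "n U") auto
    have "(real (n U) - 1)\<^sup>2 < (sqrt (real U))\<^sup>2"
      using n_less[of U] n1 by (intro power_strict_mono) auto
    then have "real ((n U - 1)\<^sup>2) < real U"
      using n1 by (simp add: of_nat_diff)
    \<comment> \<open>Both sides of the strict inequality are integers, which gains the summand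
      1.\<close>
    then have "real ((n U - 1)\<^sup>2 + 1) \<le> real U"
      by (simp only: of_nat_less_iff of_nat_le_iff less_eq_Suc_le Suc_eq_plus1)
    then have n: "(real (n U) - 1)\<^sup>2 + 1 \<le> real U"
      using n1 by (simp add: of_nat_diff)
    define F where "F = cut_max U A (n U) ` Pow {..<n U}"
    \<comment> \<open>Injectivity of the composition gives both the cardinality of \<open>F\<close>
      and the distinctness of the level sets on \<open>F\<close>.\<close>
    have inj: "inj_on (level_set U A \<circ> cut_max U A (n U)) (Pow {..<n U})"
      using inj_on_level_set_cut_max[OF n, of A] by (simp add: comp_def)
    have range: "cut_max U A (n U) T \<in> square U \<rightarrow>\<^sub>E {real A..real A + real U}"
      if "finite T" for T
    proof (rule PiE_I)
      fix p assume "p \<in> square U"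
      then show "cut_max U A (n U) T p \<in> {real A..real A + real U}"
        using that cut_le[OF n] by (auto simp: cut_max_le_iff cut_max_ge)
    qed (simp add: cut_max_def)
    have props: "nondecreasing U \<phi> \<and> piecewise_linear_on (square U) \<phi> \<and>
        convex_on (square U) \<phi> \<and> max_of_affine_on (square U) (Suc (n U)) \<phi> \<and>
        (\<forall>(i, j) \<in> {1..U} \<times> {1..U} - level_set U A \<phi>. \<phi> (real i, real j) \<ge> real A + 1)"
      if "\<phi> \<in> F" for \<phi>
    proof -
      obtain T where T: "T \<subseteq> {..<n U}" and \<phi>: "\<phi> = cut_max U A (n U) T"
        using \<open>\<phi> \<in> F\<close> unfolding F_def by blast
      have fin: "finite T"
        using T finite_subset by blast
      have "card T \<le> n U"
        using T card_mono[of "{..<n U}" T] by simp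
      then have "card (cuts U A (n U) T) \<le> Suc (n U)"
        using card_cuts_le[OF fin, of U A "n U"] by linarith
      then have "max_of_affine_on (square U) (Suc (n U)) \<phi>"
        unfolding max_of_affine_on_def \<phi>
        by (intro exI[of _ "cuts U A (n U) T"] conjI ballI)
           (simp_all add: finite_cuts fin cuts_nonempty affine_function_cuts cut_max_eq)
      moreover have "piecewise_linear_on (square U) \<phi>" unfolding \<phi>
        by (rule piecewise_linear_on_Max_affine[OF polyhedron_square finite_cuts[OF fin]
              cuts_nonempty affine_function_cuts cut_max_eq])
      moreover have "convex_on (square U) \<phi>" unfolding \<phi>
        by (rule convex_on_Max_affine[OF polyhedron_imp_convex[OF polyhedron_square]
              finite_cuts[OF fin] cuts_nonempty affine_function_cuts cut_max_eq])
      ultimately show ?thesis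
        using nondecreasing_cut_max[OF fin] cut_max_gap[OF fin] unfolding \<phi> by blast
    qed
    have "card F = 2 ^ n U"
      unfolding F_def using inj by (simp add: card_image inj_on_imageI2 card_Pow)
    moreover have "inj_on (level_set U A) F"
      unfolding F_def using inj by (rule inj_on_imageI)
    moreover have "F \<subseteq> square U \<rightarrow>\<^sub>E {real A..real A + real U}"
      unfolding F_def using range finite_subset by blast
    moreover have "finite F"
      by (simp add: F_def)
    ultimately show ?thesis
      using props by (intro exI[of _ F]) blast
  qed
  ultimately show ?thesis
    by (intro exI[of _ "\<lambda>U. 2 ^ n U"] exI[of _ "\<lambda>U. Suc (n U)"]) blast
qed

end
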